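(* Let $n,m$ be nonnegative integers. Then, for all complex numbers $\alpha$ and $\beta$, $$\sum_{k=0}^m\binom{n+m+1}{k}\alpha^{(k)}\beta^{(m-k)}=\sum_{k=0}^m\binom{n+k}{k}\alpha^{(k)}(\alpha+\beta+k)^{(m-k)}$$ $$=(n+m+1)\binom{n+m}{m}\sum_{k=0}^m\frac{(-1)^k}{k+n+1}\binom{m}{k}\beta^{(k)}(\alpha+\beta+k)^{(m-k)}.$$
   Context: For a complex number $z$ and a nonnegative integer $n$, $z^{(n)}=\prod_{j=0}^{n-1}(z+j)$ denotes the rising factorial, with $z^{(0)}=1$ (empty product). *)

theory Defs
  imports Complex_Main
begin

end

theory Submission
  imports Defs
begin

text \<open>
  Both sums on the right contain the product \<open>x\<^sup>(\<^sup>k\<^sup>) (x + y + k)\<^sup>(\<^sup>m\<^sup>-\<^sup>k\<^sup>)\<close>, with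
  \<open>(x, y)\<close> equal to \<open>(\<alpha>, \<beta>)\<close> in the first and to \<open>(\<beta>, \<alpha>)\<close> in the second. The Vandermonde identity for
  rising factorials, applied to \<open>(x + k) + y\<close>, expands this product in the family \<open>x\<^sup>(\<^sup>l\<^sup>) y\<^sup>(\<^sup>m\<^sup>-\<^sup>l\<^sup>)\<close>
  (lemma \<open>sum_pochhammer_shift_expand\<close>), and the sum on the left is already written in that family.
  So it suffices to compare coefficients.

  For the first sum, the coefficients agree by a convolution of binomial coefficients
  (lemma \<open>sum_choose_convolution\<close>). For the second, the trinomial revision
  \<open>(m choose k) (m - k choose l - k) = (m choose l) (l choose k)\<close> reduces the coefficient to the
  alternating sum of \<open>(l choose k) / (k + n + 1)\<close>, which is a partial fraction expansion
  (lemma \<open>sum_alternating_choose_divide\<close>).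
\<close>

text \<open>
  The Vandermonde step: since \<open>a\<^sup>(\<^sup>k\<^sup>) (a + k)\<^sup>(\<^sup>i\<^sup>) = a\<^sup>(\<^sup>k\<^sup>+\<^sup>i\<^sup>)\<close>, expanding \<open>((a + k) + b)\<^sup>(\<^sup>m\<^sup>-\<^sup>k\<^sup>)\<close>
  produces only terms \<open>a\<^sup>(\<^sup>l\<^sup>) b\<^sup>(\<^sup>m\<^sup>-\<^sup>l\<^sup>)\<close> with \<open>l = k + i\<close>, whatever the weights \<open>c\<close> are.
\<close>

lemma sum_pochhammer_shift_expand:
  fixes a b :: "'a::comm_ring_1"
  shows "(\<Sum>k\<le>m. c k * pochhammer a k * pochhammer (a + b + of_nat k) (m - k))
       = (\<Sum>l\<le>m. (\<Sum>k\<le>l. c k * of_nat ((m - k) choose (l - k))) * pochhammer a l * pochhammer b (m - l))"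
    (is "?L = ?R")
proof -
  define g where
    "g k l = c k * of_nat ((m - k) choose (l - k)) * pochhammer a l * pochhammer b (m - l)" for k l
  have expand: "c k * pochhammer a k * pochhammer (a + b + of_nat k) (m - k) = (\<Sum>l=k..m. g k l)"
    if "k \<le> m" for k
  proof -
    have "c k * pochhammer a k * pochhammer (a + b + of_nat k) (m - k)
        = c k * pochhammer a k * pochhammer ((a + of_nat k) + b) (m - k)"
      by (simp add: ac_simps)
    also have "\<dots> = (\<Sum>i\<le>m - k. g k (i + k))"
      unfolding pochhammer_binomial_sum[of "a + of_nat k" b] sum_distrib_left
    proof (rule sum.cong)
      fix i
      show "c k * pochhammer a k * (of_nat ((m - k) choose i) * pochhammer (a + of_nat k) i
              * pochhammer b (m - k - i)) = g k (i + k)"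
        using pochhammer_product'[of a k i] by (simp add: g_def algebra_simps)
    qed simp
    also have "\<dots> = (\<Sum>l=k..m. g k l)"
      using sum.shift_bounds_cl_nat_ivl[of "g k" 0 k "m - k"] that by (simp add: atMost_atLeast0)
    finally show ?thesis .
  qed
  have "?L = (\<Sum>k\<le>m. \<Sum>l=k..m. g k l)"
    by (intro sum.cong) (auto simp: expand)
  also have "\<dots> = (\<Sum>l\<le>m. \<Sum>k\<le>l. g k l)"
    unfolding sum.Sigma[OF finite_atMost ballI[OF finite_atMost]]
      sum.Sigma[OF finite_atMost ballI[OF finite_atLeastAtMost]]
    by (rule sum.reindex_bij_witness[where i = "\<lambda>(l, k). (k, l)" and j = "\<lambda>(k, l). (l, k)"]) auto
  also have "\<dots> = ?R"
    by (simp add: g_def sum_distrib_right)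
  finally show ?thesis .
qed

text \<open>
  Pascal's rule in \<open>m\<close> and \<open>l\<close>; on the diagonal \<open>l = m\<close> the sum is the hockey-stick identity. This is
  the comparison of coefficients of \<open>x ^ l\<close> in the product of \<open>(1 - x) powr - (n + 1)\<close> and
  \<open>(1 - x) powr - (m - l + 1)\<close>.
\<close>

lemma sum_choose_convolution:
  assumes "l \<le> m"
  shows "(\<Sum>k\<le>l. ((n + k) choose k) * ((m - k) choose (l - k))) = (n + m + 1) choose l"
  using assms
proof (induction m arbitrary: l)
  case 0
  then show ?case by simp
next
  case (Suc m)
  show ?case
  proof (cases l)
    case 0
    then show ?thesis by simp
  next
    case (Suc l')
    show ?thesis
    proof (cases "l = Suc m")
      case True
      have "(\<Sum>k\<le>l. ((n + k) choose k) * ((Suc m - k) choose (l - k))) = (\<Sum>k\<le>l. (n + k) choose k)"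
        using True by simp
      then show ?thesis
        using True sum_choose_lower[of n l] by simp
    next
      case False
      then have l': "Suc l' \<le> m"
        using Suc Suc.prems by simp
      have pascal: "((Suc m - k) choose (Suc l' - k))
          = ((m - k) choose (l' - k)) + ((m - k) choose (Suc l' - k))" if "k \<le> l'" for k
        using that l' by (simp add: Suc_diff_le)
      have "(\<Sum>k\<le>Suc l'. ((n + k) choose k) * ((Suc m - k) choose (Suc l' - k)))
          = (\<Sum>k\<le>l'. ((n + k) choose k) * ((m - k) choose (l' - k)))
            + (\<Sum>k\<le>Suc l'. ((n + k) choose k) * ((m - k) choose (Suc l' - k)))"
        by (simp add: pascal distrib_left sum.distrib)
      also have "\<dots> = ((n + m + 1) choose l') + ((n + m + 1) choose Suc l')"
        using Suc.IH[of l'] Suc.IH[of "Suc l'"] l' by simp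
      finally show ?thesis
        using Suc by simp
    qed
  qed
qed

text \<open>
  The partial fraction expansion of \<open>l! / (x (x + 1) \<dots> (x + l))\<close>. Pascal's rule turns the sum for
  \<open>l + 1\<close> into the difference of the sums for \<open>l\<close> at \<open>x\<close> and at \<open>x + 1\<close>, and the right-hand side satisfies
  the same recurrence.
\<close>

lemma sum_alternating_choose_divide:
  fixes x :: "'a::field_char_0"
  assumes "pochhammer x (Suc l) \<noteq> 0"
  shows "(\<Sum>k\<le>l. (- 1) ^ k * of_nat (l choose k) / (x + of_nat k)) = fact l / pochhammer x (Suc l)"
  using assms
proof (induction l arbitrary: x)
  case 0
  then show ?case by simp
next
  case (Suc l)
  define p where "p = pochhammer (x + 1) l"
  have nz: "x \<noteq> 0" "p \<noteq> 0" "x + 1 + of_nat l \<noteq> 0"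
    using Suc.prems
    by (auto simp: p_def pochhammer_rec[of x "Suc l"] pochhammer_Suc[of "x + 1" l])
  have P: "pochhammer x (Suc l) = x * p" "pochhammer (x + 1) (Suc l) = p * (x + 1 + of_nat l)"
    "pochhammer x (Suc (Suc l)) = x * (p * (x + 1 + of_nat l))"
    by (simp_all only: p_def pochhammer_rec[of x l] pochhammer_Suc[of "x + 1" l]
        pochhammer_rec[of x "Suc l"])
  define f where "f y j k = (- 1) ^ k * of_nat (j choose k) / (y + of_nat k)" for y :: 'a and j k
  have step: "f x (Suc l) (Suc k) = f x l (Suc k) - f (x + 1) l k" for k
    by (simp add: f_def diff_divide_distrib add_divide_distrib ring_distribs ac_simps)
  have "(\<Sum>k\<le>Suc l. f x (Suc l) k) = f x l 0 + (\<Sum>k\<le>l. f x l (Suc k) - f (x + 1) l k)"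
    unfolding sum.atMost_Suc_shift step by (simp add: f_def)
  also have "\<dots> = (\<Sum>k\<le>Suc l. f x l k) - (\<Sum>k\<le>l. f (x + 1) l k)"
    unfolding sum.atMost_Suc_shift by (simp add: sum_subtractf)
  also have "(\<Sum>k\<le>Suc l. f x l k) = (\<Sum>k\<le>l. f x l k)"
    by (simp add: f_def)
  also have "(\<Sum>k\<le>l. f x l k) - (\<Sum>k\<le>l. f (x + 1) l k)
      = fact l / pochhammer x (Suc l) - fact l / pochhammer (x + 1) (Suc l)"
    using Suc.IH[of x] Suc.IH[of "x + 1"] nz P by (simp add: f_def)
  also have "\<dots> = fact (Suc l) / pochhammer x (Suc (Suc l))"
    using nz unfolding P by (simp add: divide_simps) (simp add: algebra_simps)
  finally show ?case
    by (simp only: f_def)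
qed

text \<open>
  At \<open>x = n + 1\<close> the partial fraction expansion gives the Beta value \<open>l! n! / (n + l + 1)!\<close>, and the
  factor \<open>(n + m + 1) (n + m choose m) = (n + m + 1)! / (n! m!)\<close> turns it into a binomial coefficient.
\<close>

lemma sum_alternating_choose_convolution:
  assumes "l \<le> m"
  shows "of_nat (n + m + 1) * of_nat ((n + m) choose m) *
           (\<Sum>k\<le>l. (- 1) ^ k / of_nat (k + n + 1) * of_nat (m choose k) * of_nat ((m - k) choose (l - k)))
       = (of_nat ((n + m + 1) choose (m - l)) :: 'a::field_char_0)"
proof -
  define x :: 'a where "x = of_nat (n + 1)"
  have poch: "fact n * pochhammer x (Suc l) = fact (n + l + 1)"
    using pochhammer_product'[of "1::'a" n "Suc l"]
    by (simp add: pochhammer_fact x_def add.commute)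
  have poch_nz: "pochhammer x (Suc l) \<noteq> 0"
    using poch by (metis fact_nonzero mult_zero_right)
  have revise: "of_nat (m choose k) * of_nat ((m - k) choose (l - k))
      = (of_nat (m choose l) * of_nat (l choose k) :: 'a)" if "k \<le> l" for k
    using choose_mult[OF that assms] by (metis of_nat_mult)
  have "(\<Sum>k\<le>l. (- 1) ^ k / of_nat (k + n + 1) * of_nat (m choose k) * of_nat ((m - k) choose (l - k)))
      = (\<Sum>k\<le>l. of_nat (m choose l) * ((- 1) ^ k * of_nat (l choose k) / (x + of_nat k)))"
    by (rule sum.cong) (simp_all add: x_def mult.assoc revise ac_simps)
  also have "\<dots> = of_nat (m choose l) * (fact l / pochhammer x (Suc l))"
    by (simp only: sum_distrib_left[symmetric] sum_alternating_choose_divide[OF poch_nz])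
  also have "\<dots> = of_nat (m choose l) * (fact l * fact n / fact (n + l + 1))"
    using poch[symmetric] poch_nz by simp
  also have "\<dots> = fact m * fact n / (fact (m - l) * fact (n + l + 1))"
    using assms by (simp add: binomial_fact)
  finally have S: "(\<Sum>k\<le>l. (- 1) ^ k / of_nat (k + n + 1) * of_nat (m choose k) * of_nat ((m - k) choose (l - k)))
      = (fact m * fact n / (fact (m - l) * fact (n + l + 1)) :: 'a)" .
  have C: "of_nat (n + m + 1) * of_nat ((n + m) choose m) = (fact (n + m + 1) / (fact m * fact n) :: 'a)"
    by (simp add: binomial_fact)
  have D: "of_nat ((n + m + 1) choose (m - l))
      = (fact (n + m + 1) / (fact (m - l) * fact (n + l + 1)) :: 'a)"
  proof -
    have "n + m + 1 - (m - l) = n + l + 1"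
      using assms by simp
    then show ?thesis
      using binomial_fact[of "m - l" "n + m + 1", where 'a = 'a] by (simp del: fact_Suc)
  qed
  show ?thesis
    unfolding S C D by simp
qed

theorem mainTheorem4:
  fixes n m :: nat and \<alpha> \<beta> :: complex
  shows "(\<Sum>k=0..m. of_nat ((n + m + 1) choose k) * pochhammer \<alpha> k * pochhammer \<beta> (m - k))
       = (\<Sum>k=0..m. of_nat ((n + k) choose k) * pochhammer \<alpha> k * pochhammer (\<alpha> + \<beta> + of_nat k) (m - k))
    \<and> (\<Sum>k=0..m. of_nat ((n + k) choose k) * pochhammer \<alpha> k * pochhammer (\<alpha> + \<beta> + of_nat k) (m - k))
       = of_nat (n + m + 1) * of_nat ((n + m) choose m) *
         (\<Sum>k=0..m. (- 1) ^ k / of_nat (k + n + 1) * of_nat (m choose k) *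
            pochhammer \<beta> k * pochhammer (\<alpha> + \<beta> + of_nat k) (m - k))"
proof -
  have first: "(\<Sum>k\<le>m. of_nat ((n + k) choose k) * pochhammer \<alpha> k * pochhammer (\<alpha> + \<beta> + of_nat k) (m - k))
      = (\<Sum>l\<le>m. of_nat ((n + m + 1) choose l) * pochhammer \<alpha> l * pochhammer \<beta> (m - l))"
    unfolding sum_pochhammer_shift_expand
  proof (rule sum.cong)
    fix l
    assume "l \<in> {..m}"
    then have "(\<Sum>k\<le>l. of_nat ((n + k) choose k) * of_nat ((m - k) choose (l - k)))
        = (of_nat ((n + m + 1) choose l) :: complex)"
      by (simp only: atMost_iff of_nat_mult of_nat_sum flip: sum_choose_convolution)
    then show "(\<Sum>k\<le>l. of_nat ((n + k) choose k) * of_nat ((m - k) choose (l - k)))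
          * pochhammer \<alpha> l * pochhammer \<beta> (m - l)
        = of_nat ((n + m + 1) choose l) * pochhammer \<alpha> l * pochhammer \<beta> (m - l)"
      by simp
  qed simp
  define c :: "nat \<Rightarrow> complex"
    where "c k = (- 1) ^ k / of_nat (k + n + 1) * of_nat (m choose k)" for k
  define N :: complex where "N = of_nat (n + m + 1) * of_nat ((n + m) choose m)"
  have coeff: "N * (\<Sum>k\<le>l. c k * of_nat ((m - k) choose (l - k))) = of_nat ((n + m + 1) choose (m - l))"
    if "l \<le> m" for l
    unfolding N_def c_def by (rule sum_alternating_choose_convolution[OF that])
  have "N * (\<Sum>k\<le>m. c k * pochhammer \<beta> k * pochhammer (\<beta> + \<alpha> + of_nat k) (m - k))
      = (\<Sum>l\<le>m. N * (\<Sum>k\<le>l. c k * of_nat ((m - k) choose (l - k))) * pochhammer \<beta> l * pochhammer \<alpha> (m - l))"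
    unfolding sum_pochhammer_shift_expand by (subst sum_distrib_left) (simp only: mult.assoc)
  also have "\<dots> = (\<Sum>l\<le>m. of_nat ((n + m + 1) choose (m - l)) * pochhammer \<alpha> (m - l) * pochhammer \<beta> l)"
    by (rule sum.cong) (simp_all only: coeff atMost_iff mult.assoc mult.commute[of "pochhammer \<beta> _"])
  also have "\<dots> = (\<Sum>l\<le>m. of_nat ((n + m + 1) choose l) * pochhammer \<alpha> l * pochhammer \<beta> (m - l))"
    by (rule sum.reindex_bij_witness[where i = "\<lambda>l. m - l" and j = "\<lambda>l. m - l"]) auto
  finally have second: "N * (\<Sum>k\<le>m. c k * pochhammer \<beta> k * pochhammer (\<alpha> + \<beta> + of_nat k) (m - k))
      = (\<Sum>l\<le>m. of_nat ((n + m + 1) choose l) * pochhammer \<alpha> l * pochhammer \<beta> (m - l))"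
    by (simp only: add.commute[of \<beta> \<alpha>])
  show ?thesis
    unfolding atLeast0AtMost first by (simp only: second[unfolded N_def c_def])
qed

end
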